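(* Let $G$ be a connected simple graph with $n=|V(G)|$ vertices and minimum degree $\delta=\delta(G)$, and let $k\in(0,n)$ be a real number with $\delta\le\frac{n-k}{2}$. Each of the following holds. (i) If $q_{1}(G)<\frac{2\delta n}{n-k}$, then $\mu_{f}(G)>\frac{n-k}{2}$. (ii) If $q_{1}(\overline{G})<2(\delta+k-1)$, then $\mu_{f}(G)>\frac{n-k}{2}$.
   Context: Graphs are finite, simple and undirected. $\overline{G}$ is the complement of $G$. For a graph $H$ with adjacency matrix $A(H)$ and diagonal degree matrix $D(H)$, the $Q$-index $q_1(H)$ is the largest eigenvalue of $D(H)+A(H)$. A fractional matching of $G$ is a function $f:E(G)\to[0,1]$ such that for every vertex $v$ the sum of $f(e)$ over all edges $e$ incident with $v$ is at most $1$. The fractional matching number is $\mu_f(G)=\max\{\sum_{e\in E(G)}f(e): f \text{ is a fractional matching of } G\}$. *)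

theory Defs
  imports "Graph_Theory.Digraph_Component" "Jordan_Normal_Form.Spectral_Radius"
begin

text \<open>
  A finite simple undirected graph is a \<^locale>\<open>pair_graph\<close>: an undirected edge $uv$ is
  represented by the two arcs \<open>(u, v)\<close> and \<open>(v, u)\<close>, so the degree of a vertex is its out-degree.
\<close>

definition min_degree :: "'a pair_pre_digraph \<Rightarrow> nat" where
  "min_degree G = Min (out_degree (with_proj G) ` pverts G)"

definition complement :: "'a pair_pre_digraph \<Rightarrow> 'a pair_pre_digraph" where
  "complement G = \<lparr> pverts = pverts G,
     parcs = {(u, v). u \<in> pverts G \<and> v \<in> pverts G \<and> u \<noteq> v \<and> (u, v) \<notin> parcs G} \<rparr>"

text \<open>
  Matrices are indexed by \<open>{0..<n}\<close>, so the vertices are put into some fixed order; by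
  \<open>eigenvalue_signless_laplacian_iff\<close> below, the spectrum does not depend on the choice.
\<close>

definition vertex_list :: "'a pair_pre_digraph \<Rightarrow> 'a list" where
  "vertex_list G = (SOME vs. distinct vs \<and> set vs = pverts G)"

definition adjacency_mat :: "'a pair_pre_digraph \<Rightarrow> real mat" where
  "adjacency_mat G = mat (card (pverts G)) (card (pverts G))
     (\<lambda>(i, j). if (vertex_list G ! i, vertex_list G ! j) \<in> parcs G then 1 else 0)"

definition degree_mat :: "'a pair_pre_digraph \<Rightarrow> real mat" where
  "degree_mat G = mat (card (pverts G)) (card (pverts G))
     (\<lambda>(i, j). if i = j then real (out_degree (with_proj G) (vertex_list G ! i)) else 0)"

definition signless_laplacian :: "'a pair_pre_digraph \<Rightarrow> real mat" where
  "signless_laplacian G = degree_mat G + adjacency_mat G"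

definition Q_index :: "'a pair_pre_digraph \<Rightarrow> real" where
  "Q_index G = Max (spectrum (signless_laplacian G))"

definition edges :: "'a pair_pre_digraph \<Rightarrow> 'a set set" where
  "edges G = {{u, v} | u v. (u, v) \<in> parcs G}"

definition fractional_matching :: "'a pair_pre_digraph \<Rightarrow> ('a set \<Rightarrow> real) \<Rightarrow> bool" where
  "fractional_matching G f \<longleftrightarrow>
     (\<forall>e \<in> edges G. 0 \<le> f e \<and> f e \<le> 1) \<and>
     (\<forall>v \<in> pverts G. (\<Sum>e \<in> {e \<in> edges G. v \<in> e}. f e) \<le> 1)"

text \<open>The supremum is a maximum: the fractional matchings form a nonempty compact polytope.\<close>

definition fractional_matching_number :: "'a pair_pre_digraph \<Rightarrow> real" where
  "fractional_matching_number G =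
     (SUP f \<in> {f. fractional_matching G f}. \<Sum>e \<in> edges G. f e)"

lemma pair_graph_complement:
  assumes "pair_graph G"
  shows "pair_graph (complement G)"
proof -
  interpret pair_graph G by fact
  have "finite (parcs (complement G))"
    by (rule finite_subset[of _ "pverts G \<times> pverts G"])
      (auto simp: complement_def pair_finite_verts)
  moreover have "sym (parcs (complement G))"
    using pair_sym_arcs by (auto simp: complement_def symmetric_def sym_def)
  ultimately show ?thesis
    by unfold_locales (auto simp: complement_def symmetric_def pair_finite_verts)
qed

lemma vertex_list:
  assumes "finite (pverts G)"
  shows "distinct (vertex_list G)" "set (vertex_list G) = pverts G"
    "length (vertex_list G) = card (pverts G)"
proof -
  have "\<exists>vs. distinct vs \<and> set vs = pverts G"
    using finite_distinct_list[OF assms] by blast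
  then have *: "distinct (vertex_list G) \<and> set (vertex_list G) = pverts G"
    unfolding vertex_list_def by (rule someI_ex)
  then show "distinct (vertex_list G)" "set (vertex_list G) = pverts G" by auto
  from * show "length (vertex_list G) = card (pverts G)"
    by (metis distinct_card)
qed

lemma eigenvalue_signless_laplacian_iff:
  assumes "pair_graph G"
  shows "eigenvalue (signless_laplacian G) l \<longleftrightarrow>
    (\<exists>x. (\<exists>v \<in> pverts G. x v \<noteq> 0) \<and>
      (\<forall>v \<in> pverts G. real (out_degree (with_proj G) v) * x v +
         (\<Sum>u \<in> {u. (v, u) \<in> parcs G}. x u) = l * x v))"
proof -
  interpret pair_graph G by fact
  define vs where "vs = vertex_list G"
  define n where "n = card (pverts G)"
  have fin: "finite (pverts G)" by (rule pair_finite_verts)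
  have vs: "distinct vs" "set vs = pverts G" "length vs = n"
    using vertex_list[OF fin] by (auto simp: vs_def n_def)
  have bij: "bij_betw ((!) vs) {0..<n} (pverts G)"
    using bij_betw_nth[of vs "{0..<n}" "pverts G"] vs by (auto simp: atLeast0LessThan)
  have dim: "dim_row (signless_laplacian G) = n" "dim_col (signless_laplacian G) = n"
    by (auto simp: signless_laplacian_def degree_mat_def adjacency_mat_def n_def)
  have row: "(signless_laplacian G *\<^sub>v y) $ i =
      real (out_degree (with_proj G) (vs ! i)) * x (vs ! i) +
      (\<Sum>u \<in> {u. (vs ! i, u) \<in> parcs G}. x u)"
    if y: "y \<in> carrier_vec n" and i: "i < n" and xy: "\<And>j. j < n \<Longrightarrow> y $ j = x (vs ! j)"
    for y :: "real vec" and x i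
  proof -
    let ?d = "real (out_degree (with_proj G) (vs ! i))"
    have "(signless_laplacian G *\<^sub>v y) $ i =
        (\<Sum>j = 0..<n. ((if i = j then ?d else 0) +
           (if (vs ! i, vs ! j) \<in> parcs G then 1 else 0)) * y $ j)"
      using y i
      by (auto simp: scalar_prod_def dim signless_laplacian_def degree_mat_def
          adjacency_mat_def n_def vs_def intro!: sum.cong)
    also have "\<dots> = (\<Sum>j = 0..<n. (if i = j then ?d * x (vs ! j) else 0) +
           (if (vs ! i, vs ! j) \<in> parcs G then x (vs ! j) else 0))"
      by (rule sum.cong) (auto simp: xy algebra_simps)
    also have "\<dots> = ?d * x (vs ! i) +
        (\<Sum>j = 0..<n. if (vs ! i, vs ! j) \<in> parcs G then x (vs ! j) else 0)"
      using i by (simp add: sum.distrib)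
    also have "(\<Sum>j = 0..<n. if (vs ! i, vs ! j) \<in> parcs G then x (vs ! j) else 0) =
        (\<Sum>u \<in> pverts G. if (vs ! i, u) \<in> parcs G then x u else 0)"
      by (rule sum.reindex_bij_betw[OF bij])
    also have "\<dots> = (\<Sum>u \<in> {u \<in> pverts G. (vs ! i, u) \<in> parcs G}. x u)"
      using fin by (simp add: sum.inter_filter)
    also have "{u \<in> pverts G. (vs ! i, u) \<in> parcs G} = {u. (vs ! i, u) \<in> parcs G}"
      using in_arcsD2 by auto
    finally show ?thesis .
  qed
  show ?thesis
  proof
    assume "eigenvalue (signless_laplacian G) l"
    then obtain y where y: "y \<in> carrier_vec n" "y \<noteq> 0\<^sub>v n"
      "signless_laplacian G *\<^sub>v y = l \<cdot>\<^sub>v y"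
      by (auto simp: eigenvalue_def eigenvector_def dim)
    define x where "x v = y $ (inv_into {0..<n} ((!) vs) v)" for v
    have xy: "y $ j = x (vs ! j)" if "j < n" for j
      using that bij by (simp add: x_def bij_betw_def inv_into_f_f)
    have "\<exists>i < n. y $ i \<noteq> 0"
    proof (rule ccontr)
      assume "\<not> ?thesis"
      then have "y = 0\<^sub>v n" using y(1) by (intro eq_vecI) auto
      with y(2) show False ..
    qed
    then obtain i where i: "i < n" "y $ i \<noteq> 0" by blast
    have "vs ! i \<in> pverts G" using i(1) vs nth_mem[of i vs] by simp
    then have "\<exists>v \<in> pverts G. x v \<noteq> 0" using i xy[OF i(1)] by (intro bexI[of _ "vs ! i"]) simp_all
    moreover have "real (out_degree (with_proj G) v) * x v +
         (\<Sum>u \<in> {u. (v, u) \<in> parcs G}. x u) = l * x v" if v: "v \<in> pverts G" for v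
    proof -
      obtain j where j: "j < n" "v = vs ! j" using v vs(3) unfolding vs(2)[symmetric] in_set_conv_nth by blast
      have "(signless_laplacian G *\<^sub>v y) $ j = l * x v"
        unfolding y(3) using y(1) j xy[OF j(1)] by simp
      then show ?thesis using row[of y j x, OF y(1) j(1) xy] unfolding j(2) by linarith
    qed
    ultimately show "\<exists>x. (\<exists>v \<in> pverts G. x v \<noteq> 0) \<and>
      (\<forall>v \<in> pverts G. real (out_degree (with_proj G) v) * x v +
         (\<Sum>u \<in> {u. (v, u) \<in> parcs G}. x u) = l * x v)" by blast
  next
    assume "\<exists>x. (\<exists>v \<in> pverts G. x v \<noteq> 0) \<and>
      (\<forall>v \<in> pverts G. real (out_degree (with_proj G) v) * x v +
         (\<Sum>u \<in> {u. (v, u) \<in> parcs G}. x u) = l * x v)"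
    then obtain x w where w: "w \<in> pverts G" "x w \<noteq> 0" and
      x: "\<And>v. v \<in> pverts G \<Longrightarrow> real (out_degree (with_proj G) v) * x v +
         (\<Sum>u \<in> {u. (v, u) \<in> parcs G}. x u) = l * x v" by blast
    define y where "y = vec n (\<lambda>j. x (vs ! j))"
    have y: "y \<in> carrier_vec n" and xy: "\<And>j. j < n \<Longrightarrow> y $ j = x (vs ! j)"
      by (auto simp: y_def)
    obtain j where j: "j < n" "w = vs ! j" using w(1) vs(3) unfolding vs(2)[symmetric] in_set_conv_nth by blast
    have "y \<noteq> 0\<^sub>v n" using j w xy[OF j(1)] by auto
    moreover have "signless_laplacian G *\<^sub>v y = l \<cdot>\<^sub>v y"
    proof (rule eq_vecI)
      fix i assume "i < dim_vec (l \<cdot>\<^sub>v y)"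
      then have i: "i < n" by (simp add: y_def)
      then have "vs ! i \<in> pverts G" using vs nth_mem[of i vs] by simp
      then have "(signless_laplacian G *\<^sub>v y) $ i = l * x (vs ! i)"
        using row[of y i x, OF y i xy] x[of "vs ! i"] by linarith
      then show "(signless_laplacian G *\<^sub>v y) $ i = (l \<cdot>\<^sub>v y) $ i"
        using xy[OF i] i y by simp
    qed (simp add: dim y_def)
    ultimately show "eigenvalue (signless_laplacian G) l"
      using y by (auto simp: eigenvalue_def eigenvector_def dim)
  qed
qed

end

theory Submission
  imports Defs "HOL-Analysis.Function_Topology"
begin

text \<open>
  If \<open>\<mu>\<^sub>f(G) \<le> (n - k) / 2\<close>, the deficiency version of Hall's theorem in the bipartite double
  cover yields an independent set \<open>T\<close> whose neighbourhood lies in a set \<open>S\<close> with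
  \<open>|T| \<ge> |S| + k\<close>. By the Rayleigh principle, the at least \<open>\<delta>|T|\<close> edges between \<open>S\<close> and \<open>T\<close>
  force \<open>q\<^sub>1(G) \<ge> \<delta>(1 + |T|/|S|) \<ge> 2\<delta>n/(n - k)\<close>, and \<open>T\<close> is a clique of the complement, so
  \<open>q\<^sub>1\<close> of the complement is at least \<open>2(|T| - 1) \<ge> 2(\<delta> + k - 1)\<close>, because \<open>\<delta> \<le> |S|\<close>.
\<close>

section \<open>Hall's theorem with deficiency\<close>

text \<open>
  Induction on \<open>\<Sum>|N i|\<close>: if \<open>|N i| \<ge> 2\<close>, one of any two elements can be removed from \<open>N i\<close>, since
  violators \<open>J\<close>, \<open>K\<close> for the two removals contradict submodularity of \<open>J \<mapsto> |\<Union>(N ` J)|\<close>.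
\<close>

lemma Hall_deficiency:
  assumes "finite I" and "\<And>i. i \<in> I \<Longrightarrow> finite (N i)"
    and "\<And>J. J \<subseteq> I \<Longrightarrow> card J \<le> card (\<Union> (N ` J)) + d"
  shows "\<exists>A f. A \<subseteq> I \<and> card I \<le> card A + d \<and> inj_on f A \<and> (\<forall>i \<in> A. f i \<in> N i)"
  using assms
proof (induction "\<Sum>i \<in> I. card (N i)" arbitrary: N rule: less_induct)
  case less
  note fin = less.prems(1,2) and hall = less.prems(3)
  show ?case
  proof (cases "\<forall>i \<in> I. card (N i) \<le> 1")
    case True
    \<comment> \<open>When every \<open>N i\<close> has at most one element, any choice of an index
      for each \<open>u\<close> is injective, and its inverse is the required matching.\<close>
    define U where "U = \<Union> (N ` I)"
    have "\<forall>u \<in> U. \<exists>i \<in> I. u \<in> N i" by (auto simp: U_def)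
    then obtain g where g: "\<And>u. u \<in> U \<Longrightarrow> g u \<in> I \<and> u \<in> N (g u)" by metis
    have "N (g u) = {u}" if "u \<in> U" for u
    proof -
      have "card (N (g u)) \<le> Suc 0" "finite (N (g u))" "u \<in> N (g u)"
        using True fin(2) g[OF that] by auto
      then show ?thesis by (auto simp: card_le_Suc0_iff_eq)
    qed
    then have inj: "inj_on g U" by (metis inj_onI singleton_inject)
    have "card I \<le> card (g ` U) + d"
      using hall[of I] inj by (simp add: U_def card_image)
    moreover have "inv_into U g i \<in> N i" if "i \<in> g ` U" for i
      using g[of "inv_into U g i"] that by (simp add: f_inv_into_f inv_into_into)
    ultimately show ?thesis
      using g inj_on_inv_into[of "g ` U" g U] by (intro exI[of _ "g ` U"] exI[of _ "inv_into U g"]) auto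
  next
    case False
    then obtain i where i: "i \<in> I" "card (N i) > 1" by force
    then have "\<exists>x y. x \<in> N i \<and> y \<in> N i \<and> x \<noteq> y"
      using fin(2)[OF i(1)] by (metis One_nat_def card_le_Suc0_iff_eq not_le)
    then obtain x y where xy: "x \<in> N i" "y \<in> N i" "x \<noteq> y" by blast
    define del where "del z = N(i := N i - {z})" for z
    \<comment> \<open>A violator must contain \<open>i\<close>, since only \<open>N i\<close> has
      changed. Dropping \<open>i\<close> from it turns the strict inequality into a weak
      one.\<close>
    have violated: "\<exists>J. J \<subseteq> I - {i} \<and> card (\<Union> (N ` J) \<union> (N i - {z})) + d \<le> card J"
      if no: "\<not> (\<forall>J. J \<subseteq> I \<longrightarrow> card J \<le> card (\<Union> (del z ` J)) + d)" for z
    proof -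
      obtain J where J: "J \<subseteq> I" "card (\<Union> (del z ` J)) + d < card J"
        using no by (auto simp: not_le)
      have "i \<in> J"
      proof (rule ccontr)
        assume "i \<notin> J"
        then have "del z ` J = N ` J" by (auto simp: del_def)
        with hall[OF J(1)] J(2) show False by simp
      qed
      then have "\<Union> (del z ` J) = \<Union> (N ` (J - {i})) \<union> (N i - {z})"
        by (auto simp: del_def split: if_splits)
      moreover have "card J = Suc (card (J - {i}))"
        using \<open>i \<in> J\<close> J(1) fin(1) by (metis card.remove finite_subset)
      ultimately show ?thesis using J by (intro exI[of _ "J - {i}"]) auto
    qed
    have "\<exists>z \<in> N i. \<forall>J. J \<subseteq> I \<longrightarrow> card J \<le> card (\<Union> (del z ` J)) + d"
    proof (rule ccontr)
      assume "\<not> ?thesis"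
      then obtain J K where J: "J \<subseteq> I - {i}" "card (\<Union> (N ` J) \<union> (N i - {x})) + d \<le> card J"
        and K: "K \<subseteq> I - {i}" "card (\<Union> (N ` K) \<union> (N i - {y})) + d \<le> card K"
        using violated xy by meson
      let ?A = "\<Union> (N ` J) \<union> (N i - {x})" and ?B = "\<Union> (N ` K) \<union> (N i - {y})"
      have finJK: "finite J" "finite K"
        using finite_subset[OF J(1)] finite_subset[OF K(1)] fin(1) by auto
      have finAB: "finite ?A" "finite ?B" using finJK J(1) K(1) fin(2) i(1) by blast+
      \<comment> \<open>The Hall bounds for \<open>insert i (J \<union> K)\<close> and
        \<open>J \<inter> K\<close> add up to
        \<open>card J + card K + 1 \<le> card ?A + card ?B + 2 * d\<close>, whose right side is at
        most \<open>card J + card K\<close>. The 1 is the index \<open>i\<close>.\<close>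
      have "card (insert i (J \<union> K)) \<le> card (\<Union> (N ` insert i (J \<union> K))) + d"
        using J K i by (intro hall) auto
      also have "\<Union> (N ` insert i (J \<union> K)) = ?A \<union> ?B" using xy by auto
      finally have 1: "Suc (card (J \<union> K)) \<le> card (?A \<union> ?B) + d"
        using J K finJK by (subst (asm) card_insert_disjoint) auto
      have "card (J \<inter> K) \<le> card (\<Union> (N ` (J \<inter> K))) + d"
        using J by (intro hall) auto
      also have "card (\<Union> (N ` (J \<inter> K))) \<le> card (?A \<inter> ?B)"
        using finAB by (intro card_mono) auto
      finally show False
        using 1 J(2) K(2) card_Un_Int[OF finAB] card_Un_Int[OF finJK] by linarith
    qed
    then obtain z where z: "z \<in> N i" "\<And>J. J \<subseteq> I \<Longrightarrow> card J \<le> card (\<Union> (del z ` J)) + d"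
      by blast
    have "(\<Sum>j \<in> I. card (del z j)) < (\<Sum>j \<in> I. card (N j))"
      using fin i z(1) by (intro sum_strict_mono_ex1)
        (auto simp: del_def intro!: card_Diff1_le bexI[of _ i] card_Diff1_less)
    moreover have "finite (del z j)" if "j \<in> I" for j
      using fin(2)[OF that] by (auto simp: del_def)
    ultimately obtain A f where "A \<subseteq> I" "card I \<le> card A + d" "inj_on f A"
      "\<forall>j \<in> A. f j \<in> del z j"
      using less.hyps[of "del z", OF _ fin(1) _ z(2)] by metis
    moreover have "del z j \<subseteq> N j" for j by (auto simp: del_def)
    ultimately show ?thesis by blast
  qed
qed

section \<open>Fibre counts and compactness of the unit sphere\<close>

lemma sum_card_fibres:
  assumes "finite A" "finite F"
  shows "(\<Sum>e \<in> F. card {a \<in> A. g a = e}) = card {a \<in> A. g a \<in> F}"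
proof -
  have "card (\<Union>e \<in> F. {a \<in> A. g a = e}) = (\<Sum>e \<in> F. card {a \<in> A. g a = e})"
    using assms by (intro card_UN_disjoint) auto
  moreover have "(\<Union>e \<in> F. {a \<in> A. g a = e}) = {a \<in> A. g a \<in> F}" by auto
  ultimately show ?thesis by simp
qed

text \<open>The unit sphere becomes compact once functions are set to 0 outside \<open>V\<close>,
  which locality of \<open>q\<close> permits; homogeneity of degree 2 then carries the bound from
  the sphere to every \<open>y\<close>.\<close>

lemma ex_quadratic_form_maximiser:
  fixes q :: "('a \<Rightarrow> real) \<Rightarrow> real"
  assumes "finite V" "V \<noteq> {}" and cont: "continuous_on UNIV q"
    and scale: "\<And>c x. q (\<lambda>v. c * x v) = c\<^sup>2 * q x"
    and local: "\<And>x y. (\<And>v. v \<in> V \<Longrightarrow> x v = y v) \<Longrightarrow> q x = q y"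
  obtains m where "(\<Sum>v \<in> V. (m v)\<^sup>2) = 1" "\<And>y. q y \<le> q m * (\<Sum>v \<in> V. (y v)\<^sup>2)"
proof -
  define B where "B = (\<Pi>\<^sub>E v \<in> UNIV. if v \<in> V then {-1..1} else {0 :: real})"
  define K where "K = B \<inter> {x. (\<Sum>v \<in> V. (x v)\<^sup>2) = 1}"
  have "compactin (product_topology (\<lambda>_. euclidean) UNIV) B"
    unfolding B_def by (subst compactin_PiE) auto
  then have "compact B" by (simp add: euclidean_product_topology)
  moreover have "closed {x :: 'a \<Rightarrow> real. (\<Sum>v \<in> V. (x v)\<^sup>2) = 1}"
    by (intro closed_Collect_eq continuous_intros continuous_on_product_coordinates)
  ultimately have "compact K" by (simp add: K_def compact_Int_closed)
  have in_K: "(\<lambda>v. if v \<in> V then c * y v else 0) \<in> K"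
    if "(\<Sum>v \<in> V. (c * y v)\<^sup>2) = 1" for c y
  proof -
    have "(c * y v)\<^sup>2 \<le> 1" if "v \<in> V" for v
      using member_le_sum[of v V "\<lambda>v. (c * y v)\<^sup>2"] \<open>finite V\<close> that
        \<open>(\<Sum>v \<in> V. (c * y v)\<^sup>2) = 1\<close> by simp
    then have "\<bar>c * y v\<bar> \<le> 1" if "v \<in> V" for v
      using that by (simp add: abs_square_le_1)
    then show ?thesis using that by (auto simp: K_def B_def abs_le_iff minus_le_iff)
  qed
  have "\<exists>m \<in> K. \<forall>y \<in> K. q y \<le> q m"
  proof (rule continuous_attains_sup[OF \<open>compact K\<close>])
    obtain w where "w \<in> V" using \<open>V \<noteq> {}\<close> by blast
    then show "K \<noteq> {}"
      using in_K[of 1 "\<lambda>v. if v = w then 1 else 0"] \<open>finite V\<close>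
      by (auto simp: if_distrib[of "\<lambda>x. x\<^sup>2"] cong: if_cong)
    show "continuous_on K q" using cont continuous_on_subset by blast
  qed
  then obtain m where m: "m \<in> K" "\<And>y. y \<in> K \<Longrightarrow> q y \<le> q m" by blast
  have "q y \<le> q m * (\<Sum>v \<in> V. (y v)\<^sup>2)" for y
  proof (cases "(\<Sum>v \<in> V. (y v)\<^sup>2) = 0")
    case True
    then have "q y = q (\<lambda>v. 0 * y v)"
      using \<open>finite V\<close> by (intro local) (simp add: sum_nonneg_eq_0_iff)
    then show ?thesis using True scale[of 0 y] by simp
  next
    case False
    define r where "r = (\<Sum>v \<in> V. (y v)\<^sup>2)"
    have r: "0 < r" using False sum_nonneg[of V "\<lambda>v. (y v)\<^sup>2"] by (simp add: r_def less_le)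
    have c: "(1 / sqrt r)\<^sup>2 = 1 / r" using r by (simp add: power_divide)
    have "(\<Sum>v \<in> V. (1 / sqrt r * y v)\<^sup>2) = 1"
      using r unfolding power_mult_distrib c by (simp add: r_def flip: sum_divide_distrib)
    from m(2)[OF in_K[OF this]]
    have "q (\<lambda>v. 1 / sqrt r * y v) \<le> q m"
      using local[of "\<lambda>v. 1 / sqrt r * y v" "\<lambda>v. if v \<in> V then 1 / sqrt r * y v else 0"] by simp
    then have "1 / r * q y \<le> q m" unfolding scale c .
    then show ?thesis using r by (simp add: field_simps flip: r_def)
  qed
  then show thesis using m(1) that by (auto simp: K_def)
qed

section \<open>Arcs, edges and degrees\<close>

context pair_graph
begin

lemma arc_in_verts:
  assumes "(u, v) \<in> parcs G" shows "u \<in> pverts G" "v \<in> pverts G"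
  using assms arc_fst_in_verts arc_snd_in_verts by force+

lemma arc_sym: "(u, v) \<in> parcs G \<Longrightarrow> (v, u) \<in> parcs G"
  using pair_sym_arcs by (simp add: symmetric_def sym_def)

lemma finite_edges: "finite (edges G)"
proof -
  have "edges G = (\<lambda>(u, v). {u, v}) ` parcs G" by (auto simp: edges_def)
  then show ?thesis using pair_finite_arcs by simp
qed

lemma out_degree_eq: "out_degree (with_proj G) v = card {u. (v, u) \<in> parcs G}"
proof -
  have "out_arcs (with_proj G) v = Pair v ` {u. (v, u) \<in> parcs G}"
    by (auto simp: out_arcs_def)
  then show ?thesis by (simp add: out_degree_def card_image inj_on_def)
qed

lemma min_degree_le:
  assumes "v \<in> pverts G" shows "min_degree G \<le> card {u. (v, u) \<in> parcs G}"
  using assms pair_finite_verts by (auto simp: min_degree_def out_degree_eq)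

section \<open>Fractional matchings and the Berge-Tutte bound\<close>

text \<open>Weights are at most 1, so the number of edges bounds every total and the supremum is
  taken over a bounded set.\<close>

lemma fractional_matching_number_ge:
  assumes "fractional_matching G f"
  shows "(\<Sum>e \<in> edges G. f e) \<le> fractional_matching_number G"
proof -
  have "(\<Sum>e \<in> edges G. h e) \<le> card (edges G)" if "fractional_matching G h" for h
    using that sum_mono[of "edges G" h "\<lambda>_. 1"] by (simp add: fractional_matching_def)
  then have "bdd_above ((\<lambda>h. \<Sum>e \<in> edges G. h e) ` {h. fractional_matching G h})"
    by (auto intro!: bdd_aboveI)
  then show ?thesis
    unfolding fractional_matching_number_def using assms by (intro cSUP_upper) auto
qed

text \<open>
  Each arc \<open>(u, \<sigma> u)\<close> puts weight one half on its edge; a vertex lies on at most two of these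
  arcs, once as a tail and once as a head.
\<close>

lemma fractional_matching_number_ge_half_card:
  assumes A: "A \<subseteq> pverts G" and inj: "inj_on \<sigma> A"
    and arcs: "\<And>u. u \<in> A \<Longrightarrow> (u, \<sigma> u) \<in> parcs G"
  shows "real (card A) / 2 \<le> fractional_matching_number G"
proof -
  have finA: "finite A" using A pair_finite_verts finite_subset by blast
  define f where "f e = real (card {u \<in> A. {u, \<sigma> u} = e}) / 2" for e
  have in_edges: "{u, \<sigma> u} \<in> edges G" if "u \<in> A" for u
    using arcs[OF that] by (auto simp: edges_def)
  have sum_f: "(\<Sum>e \<in> F. f e) = real (card {u \<in> A. {u, \<sigma> u} \<in> F}) / 2" if "F \<subseteq> edges G" for F
    using sum_card_fibres[OF finA, of F "\<lambda>u. {u, \<sigma> u}"] finite_subset[OF that finite_edges]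
    unfolding f_def by (simp flip: sum_divide_distrib of_nat_sum)
  have vertex: "(\<Sum>e \<in> {e \<in> edges G. v \<in> e}. f e) \<le> 1" for v
  proof -
    have "{u \<in> A. v \<in> {u, \<sigma> u}} = {u \<in> A. u = v} \<union> {u \<in> A. \<sigma> u = v}" by auto
    then have "card {u \<in> A. v \<in> {u, \<sigma> u}} \<le> card {u \<in> A. u = v} + card {u \<in> A. \<sigma> u = v}"
      using card_Un_le[of "{u \<in> A. u = v}" "{u \<in> A. \<sigma> u = v}"] by simp
    also have "card {u \<in> A. u = v} \<le> 1"
      using card_mono[of "{v}" "{u \<in> A. u = v}"] by auto
    also have "card {u \<in> A. \<sigma> u = v} \<le> 1"
      using inj finA card_le_Suc0_iff_eq[of "{u \<in> A. \<sigma> u = v}"] by (auto simp: inj_on_def)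
    finally have "real (card {u \<in> A. v \<in> {u, \<sigma> u}}) \<le> 2" by simp
    moreover have "{u \<in> A. {u, \<sigma> u} \<in> {e \<in> edges G. v \<in> e}} = {u \<in> A. v \<in> {u, \<sigma> u}}"
      using in_edges by blast
    ultimately show ?thesis by (subst sum_f) auto
  qed
  have "f e \<le> 1" if e: "e \<in> edges G" for e
  proof -
    obtain v where "v \<in> e" using e by (auto simp: edges_def)
    then have "f e \<le> (\<Sum>e \<in> {e \<in> edges G. v \<in> e}. f e)"
      using e finite_edges by (intro member_le_sum) (auto simp: f_def)
    with vertex show ?thesis by (meson order_trans)
  qed
  then have "fractional_matching G f"
    using vertex by (auto simp: fractional_matching_def f_def)
  moreover have "(\<Sum>e \<in> edges G. f e) = real (card A) / 2"
    using in_edges by (subst sum_f) (auto intro!: arg_cong[where f = card])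
  ultimately show ?thesis using fractional_matching_number_ge by metis
qed

text \<open>
  The nontrivial half of the fractional Berge--Tutte formula. A set \<open>J\<close> with
  \<open>|J| - |N(J)| \<ge> k\<close> is a Hall violator of the bipartite double cover; discarding
  \<open>J \<inter> N(J)\<close> from both sides makes it independent.
\<close>

lemma fractional_Berge_Tutte:
  fixes k :: real
  assumes k: "0 < k" and \<mu>: "fractional_matching_number G \<le> (real (card (pverts G)) - k) / 2"
  obtains S T where "S \<subseteq> pverts G" "T \<subseteq> pverts G" "S \<inter> T = {}"
    "\<And>u v. (u, v) \<in> parcs G \<Longrightarrow> u \<in> T \<Longrightarrow> v \<in> S" "real (card S) + k \<le> real (card T)"
proof -
  define N where "N v = {u. (v, u) \<in> parcs G}" for v
  have finN: "finite (N v)" for v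
    using pair_finite_verts arc_in_verts by (auto simp: N_def intro: finite_subset[of _ "pverts G"])
  have "\<exists>J \<subseteq> pverts G. real (card (\<Union> (N ` J))) + k \<le> real (card J)"
  proof (rule ccontr)
    assume "\<not> ?thesis"
    then have less: "real (card J) < real (card (\<Union> (N ` J))) + k" if "J \<subseteq> pverts G" for J
      using that by (meson not_le)
    \<comment> \<open>\<open>d\<close> is the largest integer strictly below \<open>k\<close>:
      integrality turns the strict bound with \<open>k\<close> into a weak one with
      \<open>d\<close>, while \<open>d < k\<close> keeps the final contradiction strict.\<close>
    define d where "d = nat (\<lceil>k\<rceil> - 1)"
    have d: "real d < k" "k \<le> real d + 1" using k unfolding d_def by linarith+
    have hall: "card J \<le> card (\<Union> (N ` J)) + d" if "J \<subseteq> pverts G" for J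
      using less[OF that] d by linarith
    obtain A \<sigma> where A: "A \<subseteq> pverts G" "card (pverts G) \<le> card A + d"
      "inj_on \<sigma> A" "\<forall>u \<in> A. \<sigma> u \<in> N u"
      using Hall_deficiency[OF pair_finite_verts finN hall] by auto
    have "real (card A) / 2 \<le> fractional_matching_number G"
      using A by (intro fractional_matching_number_ge_half_card) (auto simp: N_def)
    moreover have "real (card (pverts G)) \<le> real (card A) + real d"
      using A(2) by (simp flip: of_nat_add)
    ultimately show False using \<mu> d(1) by (simp add: field_simps)
  qed
  then obtain J where J: "J \<subseteq> pverts G" "real (card (\<Union> (N ` J))) + k \<le> real (card J)" by blast
  let ?U = "\<Union> (N ` J)"
  have fin: "finite J" "finite ?U" using finite_subset[OF J(1) pair_finite_verts] finN by auto
  have "card ?U = card (?U \<inter> J) + card (?U - J)" "card J = card (J \<inter> ?U) + card (J - ?U)"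
    using fin by (metis card_Int_Diff)+
  then have "real (card (?U - J)) + k \<le> real (card (J - ?U))"
    using J(2) by (simp add: Int_commute)
  \<comment> \<open>A neighbour \<open>v\<close> of some \<open>u\<close> in \<open>J - ?U\<close>
    lies in \<open>?U\<close>; were it also in \<open>J\<close>, symmetry would put \<open>u\<close>
    into \<open>?U\<close>.\<close>
  then show thesis
    using J arc_in_verts arc_sym by (intro that[of "?U - J" "J - ?U"]) (auto simp: N_def)
qed

section \<open>The quadratic form of the signless Laplacian and the Rayleigh principle\<close>

text \<open>The bilinear form of \<open>D + A\<close>, written as a sum over edges; the division by
  2 is there because each edge is two arcs.\<close>

definition arc_form :: "('a \<Rightarrow> real) \<Rightarrow> ('a \<Rightarrow> real) \<Rightarrow> real" where
  "arc_form x y = (\<Sum>(u, v) \<in> parcs G. (x u + x v) * (y u + y v)) / 2"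

lemma sum_arcs_swap: "(\<Sum>(u, v) \<in> parcs G. h v u) = (\<Sum>(u, v) \<in> parcs G. h u v)"
proof -
  have "bij_betw (\<lambda>(u, v). (v, u)) (parcs G) (parcs G)"
    using arc_sym by (intro bij_betwI[where g = "\<lambda>(u, v). (v, u)"]) auto
  from sum.reindex_bij_betw[OF this, of "\<lambda>(u, v). h u v"] show ?thesis
    by (simp add: case_prod_unfold)
qed

text \<open>Reversing arcs shows that the \<open>y u\<close> and \<open>y v\<close> parts have equal
  sums, which cancels the division by 2; grouping by tail gives the rows of
  \<open>D + A\<close>.\<close>

lemma arc_form_conv_sum_verts:
  "arc_form x y = (\<Sum>v \<in> pverts G. y v *
     (real (out_degree (with_proj G) v) * x v + (\<Sum>u \<in> {u. (v, u) \<in> parcs G}. x u)))"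
proof -
  have arcs: "parcs G = Sigma (pverts G) (\<lambda>v. {u. (v, u) \<in> parcs G})"
    using arc_in_verts by auto
  have "arc_form x y = ((\<Sum>(u, v) \<in> parcs G. (x u + x v) * y u) +
      (\<Sum>(u, v) \<in> parcs G. (x v + x u) * y v)) / 2"
    unfolding arc_form_def sum.distrib[symmetric]
    by (intro arg_cong[where f = "\<lambda>z. z / 2"] sum.cong) (auto simp: algebra_simps)
  also have "\<dots> = (\<Sum>(u, v) \<in> parcs G. (x u + x v) * y u)"
    using sum_arcs_swap[of "\<lambda>u v. (x u + x v) * y u"] by simp
  also have "\<dots> = (\<Sum>v \<in> pverts G. \<Sum>u \<in> {u. (v, u) \<in> parcs G}. (x v + x u) * y v)"
    using pair_finite_verts arc_in_verts
    by (subst arcs, subst sum.Sigma[symmetric]) (auto intro: finite_subset[of _ "pverts G"])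
  also have "\<dots> = (\<Sum>v \<in> pverts G. y v *
     (real (out_degree (with_proj G) v) * x v + (\<Sum>u \<in> {u. (v, u) \<in> parcs G}. x u)))"
    by (intro sum.cong) (simp_all add: out_degree_eq sum.distrib algebra_simps sum_distrib_left)
  finally show ?thesis .
qed

lemma arc_form_nonneg: "0 \<le> arc_form x x"
  by (auto simp: arc_form_def intro!: sum_nonneg)

lemma arc_form_add_scaled:
  "arc_form (\<lambda>v. x v + t * y v) (\<lambda>v. x v + t * y v) =
     arc_form x x + 2 * t * arc_form x y + t\<^sup>2 * arc_form y y"
proof -
  have "arc_form (\<lambda>v. x v + t * y v) (\<lambda>v. x v + t * y v) =
      (\<Sum>(u, v) \<in> parcs G. (x u + x v) * (x u + x v) + 2 * t * ((x u + x v) * (y u + y v)) +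
        t\<^sup>2 * ((y u + y v) * (y u + y v))) / 2"
    unfolding arc_form_def
    by (intro arg_cong[where f = "\<lambda>z. z / 2"] sum.cong)
      (auto simp: power2_eq_square algebra_simps)
  then show ?thesis
    by (simp add: arc_form_def case_prod_unfold sum.distrib add_divide_distrib
        flip: sum_distrib_left)
qed

text \<open>The spectrum of a matrix is finite, so \<open>Max\<close> bounds each of its
  elements.\<close>

lemma eigenvalue_le_Q_index:
  assumes "eigenvalue (signless_laplacian G) l" shows "l \<le> Q_index G"
proof -
  have "signless_laplacian G \<in> carrier_mat (card (pverts G)) (card (pverts G))"
    by (auto simp: signless_laplacian_def degree_mat_def adjacency_mat_def)
  from card_finite_spectrum(1)[OF this] show ?thesis
    using assms by (auto simp: Q_index_def spectrum_def)
qed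

text \<open>
  By compactness the form attains its maximum on the unit sphere, and the first variation in the
  coordinate directions shows that a maximiser is an eigenvector.
\<close>

lemma arc_form_le_Q_index: "arc_form x x \<le> Q_index G * (\<Sum>v \<in> pverts G. (x v)\<^sup>2)"
proof (cases "pverts G = {}")
  case True
  then show ?thesis by (simp add: arc_form_conv_sum_verts)
next
  case False
  obtain m where m: "(\<Sum>v \<in> pverts G. (m v)\<^sup>2) = 1"
    and max: "\<And>y. arc_form y y \<le> arc_form m m * (\<Sum>v \<in> pverts G. (y v)\<^sup>2)"
  proof (rule ex_quadratic_form_maximiser[OF pair_finite_verts False, of "\<lambda>x. arc_form x x"])
    show "continuous_on UNIV (\<lambda>x. arc_form x x)"
      unfolding arc_form_def case_prod_unfold
      by (intro continuous_intros continuous_on_product_coordinates) simp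
    show "arc_form (\<lambda>v. c * x v) (\<lambda>v. c * x v) = c\<^sup>2 * arc_form x x" for c x
      using arc_form_add_scaled[of "\<lambda>_. 0" c x] by (simp add: arc_form_def)
    show "arc_form x x = arc_form y y" if "\<And>v. v \<in> pverts G \<Longrightarrow> x v = y v" for x y
      unfolding arc_form_def using that arc_in_verts
      by (intro arg_cong[where f = "\<lambda>z. z / 2"] sum.cong) auto
  qed blast
  define M where "M = arc_form m m"
  have "real (out_degree (with_proj G) w) * m w + (\<Sum>u \<in> {u. (w, u) \<in> parcs G}. m u) = M * m w"
    if w: "w \<in> pverts G" for w
  proof -
    define y where "y v = (if v = w then 1 else 0 :: real)" for v
    \<comment> \<open>\<open>c\<close> is the \<open>w\<close> entry of
      \<open>(D + A) m - M m\<close>, half the derivative at \<open>t = 0\<close> of the form minus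
      \<open>M\<close> times the squared norm along \<open>m + t y\<close>.\<close>
    define c where "c = arc_form m y - M * m w"
    \<comment> \<open>The added 1 keeps \<open>C\<close> positive even when \<open>M\<close> is
      0.\<close>
    define C where "C = M + 1"
    have le: "2 * t * c \<le> t\<^sup>2 * C" for t
    proof -
      have "(\<Sum>v \<in> pverts G. (m v + t * y v)\<^sup>2) =
          (\<Sum>v \<in> pverts G. (m v)\<^sup>2 + (if v = w then 2 * t * m w + t\<^sup>2 else 0))"
        by (intro sum.cong) (auto simp: y_def power2_eq_square algebra_simps)
      also have "\<dots> = 1 + 2 * t * m w + t\<^sup>2"
        using m w pair_finite_verts by (simp add: sum.distrib)
      finally have "M + 2 * t * arc_form m y + t\<^sup>2 * arc_form y y \<le> M * (1 + 2 * t * m w + t\<^sup>2)"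
        using max[of "\<lambda>v. m v + t * y v"] by (simp add: arc_form_add_scaled M_def)
      moreover have "0 \<le> t\<^sup>2 * arc_form y y" by (simp add: arc_form_nonneg)
      moreover have "t\<^sup>2 * M \<le> t\<^sup>2 * C" by (intro mult_left_mono) (simp_all add: C_def)
      ultimately show ?thesis by (simp add: c_def algebra_simps)
    qed
    have "0 < C" using arc_form_nonneg[of m] by (simp add: C_def M_def)
    \<comment> \<open>A linear term bounded by a quadratic one for all \<open>t\<close> must vanish;
      \<open>t = c / C\<close> exhibits this.\<close>
    then have "2 * (c * c) \<le> c * c"
      using le[of "c / C"] by (simp add: power2_eq_square field_simps)
    then have "c * c \<le> 0" by simp
    then have "c = 0" by (auto simp: mult_le_0_iff)
    moreover have "arc_form m y = (\<Sum>v \<in> pverts G. if v = w then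
        real (out_degree (with_proj G) w) * m w + (\<Sum>u \<in> {u. (w, u) \<in> parcs G}. m u) else 0)"
      unfolding arc_form_conv_sum_verts by (intro sum.cong) (auto simp: y_def)
    ultimately show ?thesis
      using w pair_finite_verts by (simp add: c_def)
  qed
  moreover have "\<exists>v \<in> pverts G. m v \<noteq> 0"
    using m by (metis (no_types, lifting) power_zero_numeral sum.neutral zero_neq_one)
  ultimately have "eigenvalue (signless_laplacian G) M"
    using eigenvalue_signless_laplacian_iff[OF pair_graph_axioms] by blast
  then have "M \<le> Q_index G" by (rule eigenvalue_le_Q_index)
  then have "M * (\<Sum>v \<in> pverts G. (x v)\<^sup>2) \<le> Q_index G * (\<Sum>v \<in> pverts G. (x v)\<^sup>2)"
    by (intro mult_right_mono sum_nonneg) auto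
  with max[of x] show ?thesis by (simp add: M_def)
qed

lemma Q_index_nonneg:
  assumes "pverts G \<noteq> {}" shows "0 \<le> Q_index G"
proof -
  have "0 \<le> Q_index G * real (card (pverts G))"
    using arc_form_le_Q_index[of "\<lambda>_. 1"] arc_form_nonneg[of "\<lambda>_. 1"] by simp
  then show ?thesis
    using assms pair_finite_verts by (simp add: zero_le_mult_iff card_gt_0_iff)
qed

section \<open>Lower bounds for the Q-index from bipartite pieces and cliques\<close>

text \<open>
  The test vector \<open>|S|\<close> on \<open>T\<close> and \<open>|T|\<close> on \<open>S\<close> maximises
  \<open>(a + b)\<^sup>2 / (|T| a\<^sup>2 + |S| b\<^sup>2)\<close>.
\<close>

lemma Q_index_ge_bipartite:
  assumes ST: "S \<subseteq> pverts G" "T \<subseteq> pverts G" "S \<inter> T = {}" "S \<noteq> {}" "T \<noteq> {}"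
    and nbr: "\<And>u v. (u, v) \<in> parcs G \<Longrightarrow> u \<in> T \<Longrightarrow> v \<in> S"
    and deg: "\<And>v. v \<in> T \<Longrightarrow> d \<le> card {u. (v, u) \<in> parcs G}"
  shows "real d * real (card S + card T) \<le> Q_index G * real (card S)"
proof -
  have fin: "finite S" "finite T" using ST pair_finite_verts finite_subset by blast+
  define s where "s = real (card S)"
  define t where "t = real (card T)"
  have pos: "0 < s" "0 < t" using fin ST by (simp_all add: s_def t_def card_gt_0_iff)
  define x where "x v = (if v \<in> T then s else if v \<in> S then t else 0)" for v
  define E where "E = Sigma T (\<lambda>v. {u. (v, u) \<in> parcs G})"
  \<comment> \<open>All arcs leaving \<open>T\<close> end in \<open>S\<close>, so these arcs and
    their reversals are disjoint: the former start in \<open>T\<close>, the latter in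
    \<open>S\<close>.\<close>
  have E: "E \<subseteq> parcs G" "prod.swap ` E \<subseteq> parcs G" "E \<inter> prod.swap ` E = {}"
    using arc_sym nbr ST(3) by (auto simp: E_def) blast
  have finE: "finite E" using E(1) pair_finite_arcs finite_subset by blast
  have "d * card T \<le> (\<Sum>v \<in> T. card {u. (v, u) \<in> parcs G})"
    using sum_mono[of T "\<lambda>_. d"] deg by (simp add: mult.commute)
  also have "\<dots> = card E"
    unfolding E_def using fin pair_finite_verts arc_in_verts
    by (subst card_SigmaI) (auto intro: finite_subset[of _ "pverts G"])
  finally have dt: "real d * t \<le> real (card E)" by (simp add: t_def flip: of_nat_mult)
  have sq: "(\<Sum>(u, v) \<in> E. (x u + x v)\<^sup>2) = real (card E) * (s + t)\<^sup>2"
  proof -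
    have "(\<Sum>(u, v) \<in> E. (x u + x v)\<^sup>2) = (\<Sum>_ \<in> E. (s + t)\<^sup>2)"
    proof (intro sum.cong refl)
      fix e assume "e \<in> E"
      then obtain u v where "e = (u, v)" "u \<in> T" "v \<in> S" using nbr by (auto simp: E_def)
      moreover from this have "v \<notin> T" using ST(3) by blast
      ultimately show "(case e of (u, v) \<Rightarrow> (x u + x v)\<^sup>2) = (s + t)\<^sup>2" by (simp add: x_def)
    qed
    then show ?thesis by simp
  qed
  have "2 * (real (card E) * (s + t)\<^sup>2) =
      (\<Sum>(u, v) \<in> E. (x u + x v)\<^sup>2) + (\<Sum>(u, v) \<in> prod.swap ` E. (x u + x v)\<^sup>2)"
    using sq by (subst sum.reindex) (auto simp: case_prod_unfold add.commute)
  also have "\<dots> = (\<Sum>(u, v) \<in> E \<union> prod.swap ` E. (x u + x v)\<^sup>2)"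
    using E finE by (subst sum.union_disjoint) auto
  also have "\<dots> \<le> (\<Sum>(u, v) \<in> parcs G. (x u + x v)\<^sup>2)"
    using E pair_finite_arcs by (intro sum_mono2) auto
  also have "\<dots> = 2 * arc_form x x" by (simp add: arc_form_def power2_eq_square)
  also have "\<dots> \<le> 2 * (Q_index G * (\<Sum>v \<in> pverts G. (x v)\<^sup>2))"
    using arc_form_le_Q_index by simp
  also have "(\<Sum>v \<in> pverts G. (x v)\<^sup>2) = (\<Sum>v \<in> S \<union> T. (x v)\<^sup>2)"
    using ST pair_finite_verts by (intro sum.mono_neutral_right) (auto simp: x_def)
  also have "\<dots> = (\<Sum>v \<in> S. (x v)\<^sup>2) + (\<Sum>v \<in> T. (x v)\<^sup>2)"
    using ST fin by (intro sum.union_disjoint) auto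
  also have "(\<Sum>v \<in> S. (x v)\<^sup>2) = (\<Sum>v \<in> S. t\<^sup>2)"
    using ST by (intro sum.cong) (auto simp: x_def)
  also have "(\<Sum>v \<in> T. (x v)\<^sup>2) = (\<Sum>v \<in> T. s\<^sup>2)"
    by (intro sum.cong) (auto simp: x_def)
  finally have "real (card E) * (s + t)\<^sup>2 \<le> Q_index G * (s * t\<^sup>2 + t * s\<^sup>2)"
    by (simp add: s_def t_def)
  \<comment> \<open>This factorisation lets one factor \<open>s + t\<close> cancel against the
    square on the left.\<close>
  also have "\<dots> = (Q_index G * s * t) * (s + t)" by (simp add: power2_eq_square algebra_simps)
  finally have "real (card E) * (s + t) \<le> Q_index G * s * t"
    using pos by (simp add: power2_eq_square flip: mult.assoc)
  moreover have "real d * t * (s + t) \<le> real (card E) * (s + t)"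
    using dt pos by (intro mult_right_mono) auto
  ultimately have "(real d * (s + t)) * t \<le> (Q_index G * s) * t" by (simp add: algebra_simps)
  then show ?thesis using pos by (simp add: s_def t_def)
qed

text \<open>Rayleigh quotient of the indicator of \<open>T\<close>: each of the
  \<open>card T * (card T - 1)\<close> arcs inside \<open>T\<close> contributes 4 before halving,
  and all other arcs contribute nonnegative amounts.\<close>

lemma Q_index_ge_clique:
  assumes T: "T \<subseteq> pverts G" "T \<noteq> {}"
    and clique: "\<And>u v. u \<in> T \<Longrightarrow> v \<in> T \<Longrightarrow> u \<noteq> v \<Longrightarrow> (u, v) \<in> parcs G"
  shows "2 * (real (card T) - 1) \<le> Q_index G"
proof -
  have fin: "finite T" using T(1) pair_finite_verts finite_subset by blast
  then have pos: "0 < card T" using T(2) by (simp add: card_gt_0_iff)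
  define x where "x v = (if v \<in> T then 1 else 0 :: real)" for v
  define E where "E = Sigma T (\<lambda>v. T - {v})"
  have "card E = (\<Sum>v \<in> T. card T - 1)"
    unfolding E_def using fin by (subst card_SigmaI) auto
  then have "real (card E) = real (card T) * (real (card T) - 1)" using pos by (simp add: of_nat_diff)
  then have "4 * (real (card T) * (real (card T) - 1)) = (\<Sum>_ \<in> E. 4)" by simp
  also have "\<dots> = (\<Sum>(u, v) \<in> E. (x u + x v)\<^sup>2)"
    by (intro sum.cong) (auto simp: E_def x_def)
  also have "\<dots> \<le> (\<Sum>(u, v) \<in> parcs G. (x u + x v)\<^sup>2)"
    using clique pair_finite_arcs by (intro sum_mono2) (auto simp: E_def)
  also have "\<dots> = 2 * arc_form x x" by (simp add: arc_form_def power2_eq_square)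
  also have "\<dots> \<le> 2 * (Q_index G * (\<Sum>v \<in> pverts G. (x v)\<^sup>2))"
    using arc_form_le_Q_index by simp
  also have "(\<Sum>v \<in> pverts G. (x v)\<^sup>2) = (\<Sum>v \<in> T. (x v)\<^sup>2)"
    using T pair_finite_verts by (intro sum.mono_neutral_right) (auto simp: x_def)
  also have "\<dots> = real (card T)" by (simp add: x_def)
  finally have "(2 * (real (card T) - 1)) * real (card T) \<le> Q_index G * real (card T)"
    by (simp add: algebra_simps)
  then show ?thesis using pos by simp
qed

end

section \<open>Both spectral conditions refuted by one pair \<open>S\<close>,
  \<open>T\<close>\<close>

theorem corollary1p5:
  fixes G :: "'a pair_pre_digraph" and n \<delta> :: nat and k :: real
  assumes "pair_graph G"
    and "Digraph_Component.connected (with_proj G)"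
    and "n = card (pverts G)"
    and "\<delta> = min_degree G"
    and "0 < k" and "k < real n"
    and "real \<delta> \<le> (real n - k) / 2"
  shows "(Q_index G < 2 * real \<delta> * real n / (real n - k) \<longrightarrow>
            fractional_matching_number G > (real n - k) / 2) \<and>
         (Q_index (complement G) < 2 * (real \<delta> + k - 1) \<longrightarrow>
            fractional_matching_number G > (real n - k) / 2)"
proof (cases "fractional_matching_number G > (real n - k) / 2")
  case True
  then show ?thesis by simp
next
  \<comment> \<open>The two implications share their conclusion; where it fails, lower bounds on
    both Q-indices contradict the two premises.\<close>
  case False
  interpret pair_graph G by fact
  interpret co: pair_graph "complement G" using assms(1) by (rule pair_graph_complement)
  obtain S T where ST: "S \<subseteq> pverts G" "T \<subseteq> pverts G" "S \<inter> T = {}"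
    and nbr: "\<And>u v. (u, v) \<in> parcs G \<Longrightarrow> u \<in> T \<Longrightarrow> v \<in> S"
    and large: "real (card S) + k \<le> real (card T)"
    using False assms(3) by (auto intro: fractional_Berge_Tutte[OF assms(5)])
  have fin: "finite S" "finite T" using ST pair_finite_verts finite_subset by blast+
  have T: "T \<noteq> {}" using large assms(5) by auto
  have deg: "\<delta> \<le> card {u. (v, u) \<in> parcs G}" if "v \<in> T" for v
    using min_degree_le that ST assms(4) by auto
  have \<delta>S: "\<delta> \<le> card S"
  proof -
    obtain v where v: "v \<in> T" using T by blast
    have "card {u. (v, u) \<in> parcs G} \<le> card S"
      using nbr v fin by (intro card_mono) auto
    with deg[OF v] show ?thesis by simp
  qed
  have "2 * real \<delta> * real n / (real n - k) \<le> Q_index G"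
  proof (cases "S = {}")
    \<comment> \<open>Here \<delta> \<le> \<open>card S\<close> forces \<delta> = 0, so the claimed
      lower bound is 0.\<close>
    case True
    then show ?thesis using \<delta>S Q_index_nonneg ST(2) T by auto
  next
    case S: False
    define s where "s = real (card S)"
    have pos: "0 < s" using S fin by (simp add: s_def card_gt_0_iff)
    have "card S + card T \<le> n"
      using ST fin pair_finite_verts assms(3) by (metis Un_least card_Un_disjoint card_mono)
    then have "2 * s \<le> real n - k" using large by (simp add: s_def flip: of_nat_add)
    \<comment> \<open>The right side exceeds the left by \<open>k * (n - k - 2 * s)\<close>.\<close>
    then have "2 * s * real n \<le> (2 * s + k) * (real n - k)"
      using mult_left_mono[of "2 * s" "real n - k" k] assms(5) by (simp add: algebra_simps)
    also have "\<dots> \<le> real (card S + card T) * (real n - k)"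
      using large assms(6) by (intro mult_right_mono) (auto simp: s_def)
    finally have "2 * s * real n \<le> real (card S + card T) * (real n - k)" .
    then have "real \<delta> * (2 * s * real n) \<le> real \<delta> * (real (card S + card T) * (real n - k))"
      by (intro mult_left_mono) auto
    also have "\<dots> \<le> (Q_index G * s) * (real n - k)"
      using Q_index_ge_bipartite[OF ST S T nbr deg] assms(6)
      by (simp add: s_def mult_right_mono flip: mult.assoc)
    finally have "s * (2 * real \<delta> * real n) \<le> s * (Q_index G * (real n - k))"
      by (simp add: algebra_simps)
    then show ?thesis using pos assms(6) by (simp add: divide_le_eq)
  qed
  moreover have "2 * (real \<delta> + k - 1) \<le> Q_index (complement G)"
  proof -
    have "2 * (real (card T) - 1) \<le> Q_index (complement G)"
    proof (rule co.Q_index_ge_clique[OF _ T])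
      show "T \<subseteq> pverts (complement G)" using ST(2) by (simp add: complement_def)
      show "(u, v) \<in> parcs (complement G)" if "u \<in> T" "v \<in> T" "u \<noteq> v" for u v
        using that ST(2,3) nbr[of u v] by (auto simp: complement_def)
    qed
    with large \<delta>S show ?thesis by simp
  qed
  ultimately show ?thesis by simp
qed

end
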